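(* Let $s\ge0$ and let $G$ be a finitely generated group with property $\mathrm{RD}^s$, with constant $C>0$. If $n,k\ge0$ are integers and $A\subseteq B_n$ and $B\subseteq B_k$ are finite non-empty subsets of $G$, then $$|AB|\ge\frac{|A|\,|B|}{C^2(1+\min\{n,k\})^{2s}}.$$ In particular, $G$ has large product growth.
   Context: $G$ is equipped with the word length $|\cdot|$ of a fixed finite generating set; $B_n=\{g\in G:|g|\le n\}$ and $AB=\{ab:a\in A,b\in B\}$. For $t\in G$ let $\lambda(t)$ be the left regular representation on $\ell^2(G)$, $(\lambda(t)\xi)(h)=\xi(t^{-1}h)$, and for finitely supported $f:G\to\mathbb C$ put $\lambda(f)=\sum_{t\in G}f(t)\lambda(t)$, with operator norm $\|\lambda(f)\|$ on $\ell^2(G)$. For $s\ge0$ set $\|f\|_{\ell^2_s}^2=\sum_{g\in G}|f(g)|^2(1+|g|)^{2s}$. The group $G$ has property $\mathrm{RD}^s$ with constant $C>0$ if $\|\lambda(f)\|\le C\|f\|_{\ell^2_s}$ for every finitely supported $f:G\to\mathbb C$. The group $G$ has large product growth if there exists a polynomial $P$ such that, for all $n,k$ and all finite subsets $U\subseteq B_n$ and $V\subseteq B_k$, $|UV|\ge\frac{|U|\,|V|}{P(n+k)}$. *)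

theory Defs
  imports
    "HOL-Analysis.Infinite_Sum"
    "HOL-Algebra.Generated_Groups"
    "HOL-Computational_Algebra.Polynomial"
begin

definition generates :: "('a, 'm) monoid_scheme \<Rightarrow> 'a set \<Rightarrow> bool" where
  "generates G S \<longleftrightarrow> S \<subseteq> carrier G \<and> generate G S = carrier G"

(* S need not be symmetric: words use letters from S and their inverses. *)
definition word_length :: "('a, 'm) monoid_scheme \<Rightarrow> 'a set \<Rightarrow> 'a \<Rightarrow> nat" where
  "word_length G S g =
    (LEAST n. \<exists>ws. length ws = n \<and> set ws \<subseteq> S \<union> m_inv G ` S \<and>
                  foldr (mult G) ws (one G) = g)"

definition word_ball :: "('a, 'm) monoid_scheme \<Rightarrow> 'a set \<Rightarrow> nat \<Rightarrow> 'a set" where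
  "word_ball G S n = {g \<in> carrier G. word_length G S g \<le> n}"

(* Functions on the group are total functions on the ambient type; their values outside
   the carrier are never used by any of the notions below. *)
definition ell2 :: "('a, 'm) monoid_scheme \<Rightarrow> ('a \<Rightarrow> complex) set" where
  "ell2 G = {\<xi>. (\<lambda>g. (cmod (\<xi> g))\<^sup>2) summable_on carrier G}"

definition ell2_norm :: "('a, 'm) monoid_scheme \<Rightarrow> ('a \<Rightarrow> complex) \<Rightarrow> real" where
  "ell2_norm G \<xi> = sqrt (\<Sum>\<^sub>\<infinity>g\<in>carrier G. (cmod (\<xi> g))\<^sup>2)"

(* The operator norm on ell2.  The supremum is taken in the reals, so it is meaningful for
   bounded operators only; it is applied below to finite linear combinations of the unitary
   operators left_regular G t. *)
definition ell2_op_norm ::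
  "('a, 'm) monoid_scheme \<Rightarrow> (('a \<Rightarrow> complex) \<Rightarrow> ('a \<Rightarrow> complex)) \<Rightarrow> real" where
  "ell2_op_norm G T = (SUP \<xi>\<in>{\<xi> \<in> ell2 G. ell2_norm G \<xi> \<le> 1}. ell2_norm G (T \<xi>))"

definition supp :: "('a, 'm) monoid_scheme \<Rightarrow> ('a \<Rightarrow> complex) \<Rightarrow> 'a set" where
  "supp G f = {t \<in> carrier G. f t \<noteq> 0}"

definition left_regular ::
  "('a, 'm) monoid_scheme \<Rightarrow> 'a \<Rightarrow> ('a \<Rightarrow> complex) \<Rightarrow> ('a \<Rightarrow> complex)" where
  "left_regular G t \<xi> = (\<lambda>h. \<xi> (inv\<^bsub>G\<^esub> t \<otimes>\<^bsub>G\<^esub> h))"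

definition left_regular_fun ::
  "('a, 'm) monoid_scheme \<Rightarrow> ('a \<Rightarrow> complex) \<Rightarrow> ('a \<Rightarrow> complex) \<Rightarrow> ('a \<Rightarrow> complex)" where
  "left_regular_fun G f \<xi> = (\<lambda>h. \<Sum>t\<in>supp G f. f t * left_regular G t \<xi> h)"

(* Used for finitely supported f only. *)
definition sobolev_norm ::
  "('a, 'm) monoid_scheme \<Rightarrow> 'a set \<Rightarrow> real \<Rightarrow> ('a \<Rightarrow> complex) \<Rightarrow> real" where
  "sobolev_norm G S s f =
    sqrt (\<Sum>g\<in>supp G f. (cmod (f g))\<^sup>2 * (1 + real (word_length G S g)) powr (2 * s))"

definition rapid_decay ::
  "('a, 'm) monoid_scheme \<Rightarrow> 'a set \<Rightarrow> real \<Rightarrow> real \<Rightarrow> bool" where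
  "rapid_decay G S s C \<longleftrightarrow>
    (\<forall>f. finite (supp G f) \<longrightarrow>
       ell2_op_norm G (left_regular_fun G f) \<le> C * sobolev_norm G S s f)"

(* Positivity of P on the naturals is implicit in dividing by P (n + k).  It has to be
   stated, as otherwise the zero polynomial would do (x / 0 = 0), or a negative constant. *)
definition large_product_growth :: "('a, 'm) monoid_scheme \<Rightarrow> 'a set \<Rightarrow> bool" where
  "large_product_growth G S \<longleftrightarrow>
    (\<exists>P :: real poly. (\<forall>m::nat. poly P (real m) > 0) \<and>
      (\<forall>n k U V. finite U \<longrightarrow> finite V \<longrightarrow>
         U \<subseteq> word_ball G S n \<longrightarrow> V \<subseteq> word_ball G S k \<longrightarrow>
         real (card (U <#>\<^bsub>G\<^esub> V)) \<ge> real (card U) * real (card V) / poly P (real (n + k))))"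

end

theory Submission
  imports Defs "HOL-Analysis.Convex"
begin

text \<open>
  Test the rapid decay inequality on indicator functions.  The convolution
  \<open>\<lambda>(1\<^sub>A) 1\<^sub>B\<close> counts the factorisations of a group element as an element of \<open>A\<close> times
  an element of \<open>B\<close>, so its total mass over the set \<open>AB\<close> is \<open>|A| |B|\<close>.
  By Cauchy-Schwarz, that much mass on \<open>|AB|\<close> points forces an \<open>\<ell>\<^sup>2\<close> norm of at least
  \<open>|A| |B| / sqrt |AB|\<close>.  Rapid decay bounds the same norm from above by
  \<open>C (1 + n)\<^sup>s sqrt |A| sqrt |B|\<close> when \<open>A\<close> lies in the ball of radius \<open>n\<close>, and comparing
  the two gives the estimate with the radius of the \<^emph>\<open>left\<close> factor
  (\<open>card_set_mult_ge_left\<close>).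

  Inversion preserves word length and turns \<open>AB\<close> into \<open>B\<inverse>A\<inverse>\<close>, so the
  same estimate holds with the radius of the right factor, hence with the smaller of the two.
  Large product growth follows with a polynomial that dominates \<open>C\<^sup>2 (1 + x)\<^bsup>2s\<^esup>\<close>.

  The operator norm is a supremum of real numbers, which bounds its members only if the set is
  bounded above; an elementary estimate of \<open>\<lambda>(f)\<close> (\<open>left_regular_fun_bounded\<close>) supplies this.
\<close>

section \<open>The left regular representation on finitely supported functions\<close>

lemma has_sum_finite_sum:
  fixes f :: "'i \<Rightarrow> 'b \<Rightarrow> 'c :: topological_comm_monoid_add"
  assumes "finite I" "\<And>i. i \<in> I \<Longrightarrow> (f i has_sum a i) A"
  shows "((\<lambda>x. \<Sum>i\<in>I. f i x) has_sum (\<Sum>i\<in>I. a i)) A"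
  using assms by (induction I rule: finite_induct) (auto intro: has_sum_add)

lemma ell2_norm_nonneg: "0 \<le> ell2_norm G \<xi>"
  by (simp add: ell2_norm_def infsum_nonneg)

lemma ell2_norm_power2: "(ell2_norm G \<xi>)\<^sup>2 = (\<Sum>\<^sub>\<infinity>g\<in>carrier G. (cmod (\<xi> g))\<^sup>2)"
  by (simp add: ell2_norm_def infsum_nonneg)

lemma ell2_norm_scale: "ell2_norm G (\<lambda>g. c * \<xi> g) = cmod c * ell2_norm G \<xi>"
  by (simp add: ell2_norm_def norm_mult power_mult_distrib infsum_cmult_right' real_sqrt_mult)

lemma ell2_scale: "\<xi> \<in> ell2 G \<Longrightarrow> (\<lambda>g. c * \<xi> g) \<in> ell2 G"
  by (simp add: ell2_def norm_mult power_mult_distrib summable_on_cmult_right)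

lemma sum_le_ell2_norm_power2:
  assumes "\<xi> \<in> ell2 G" "finite F" "F \<subseteq> carrier G"
  shows "(\<Sum>g\<in>F. (cmod (\<xi> g))\<^sup>2) \<le> (ell2_norm G \<xi>)\<^sup>2"
  unfolding ell2_norm_power2 using assms
  by (intro finite_sum_le_infsum) (auto simp: ell2_def)

lemma ell2_indicator:
  assumes "finite B" "B \<subseteq> carrier G"
  shows "(indicator B :: _ \<Rightarrow> complex) \<in> ell2 G"
    and "ell2_norm G (indicator B) = sqrt (real (card B))"
proof -
  have 1: "((\<lambda>g. (cmod (indicator B g))\<^sup>2) has_sum (\<Sum>g\<in>B. (cmod (indicator B g))\<^sup>2)) B"
    using assms(1) by (rule has_sum_finite)
  have "((\<lambda>g. (cmod (indicator B g))\<^sup>2) has_sum real (card B)) (carrier G)"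
  proof (rule has_sum_cong_neutral[THEN iffD1])
    show "((\<lambda>g. (cmod (indicator B g))\<^sup>2) has_sum real (card B)) B"
      using 1 by simp
  qed (use assms in auto)
  then show "(indicator B :: _ \<Rightarrow> complex) \<in> ell2 G"
    and "ell2_norm G (indicator B) = sqrt (real (card B))"
    by (auto simp: ell2_def ell2_norm_def summable_on_def infsumI)
qed

context group
begin

lemma bij_betw_left_translation:
  assumes "t \<in> carrier G"
  shows "bij_betw (\<lambda>h. inv t \<otimes> h) (carrier G) (carrier G)"
  by (rule bij_betw_byWitness[where f' = "\<lambda>h. t \<otimes> h"])
     (use assms in \<open>auto simp: m_assoc[symmetric]\<close>)

lemma left_regular_isometry:
  assumes t: "t \<in> carrier G" and "\<xi> \<in> ell2 G"
  shows "((\<lambda>h. (cmod (left_regular G t \<xi> h))\<^sup>2) has_sum (ell2_norm G \<xi>)\<^sup>2) (carrier G)"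
proof -
  have "((\<lambda>g. (cmod (\<xi> g))\<^sup>2) has_sum (ell2_norm G \<xi>)\<^sup>2) (carrier G)"
    using assms(2) unfolding ell2_norm_power2 ell2_def by (auto intro: has_sum_infsum)
  then show ?thesis
    using has_sum_reindex_bij_betw[OF bij_betw_left_translation[OF t], of "\<lambda>g. (cmod (\<xi> g))\<^sup>2"]
    by (simp add: left_regular_def)
qed

text \<open>
  Cauchy-Schwarz over the finite support of \<open>f\<close>, followed by summation over the group: each of
  the \<open>|supp f|\<close> translates of \<open>\<xi>\<close> contributes the same squared norm.  The constant is crude,
  but any bound makes the supremum in the operator norm meaningful.
\<close>

lemma left_regular_fun_bounded:
  assumes "finite (supp G f)" "\<xi> \<in> ell2 G"
  defines "K \<equiv> sqrt ((\<Sum>t\<in>supp G f. (cmod (f t))\<^sup>2) * real (card (supp G f)))"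
  shows "left_regular_fun G f \<xi> \<in> ell2 G"
    and "ell2_norm G (left_regular_fun G f \<xi>) \<le> K * ell2_norm G \<xi>"
proof -
  define F where "F = supp G f"
  define M where "M = (\<Sum>t\<in>F. (cmod (f t))\<^sup>2)"
  have F: "finite F" "F \<subseteq> carrier G"
    using assms(1) by (auto simp: F_def supp_def)
  have M0: "0 \<le> M" by (simp add: M_def sum_nonneg)
  let ?b = "\<lambda>h. M * (\<Sum>t\<in>F. (cmod (left_regular G t \<xi> h))\<^sup>2)"
  have pointwise: "(cmod (left_regular_fun G f \<xi> h))\<^sup>2 \<le> ?b h" for h
  proof -
    have "cmod (left_regular_fun G f \<xi> h) \<le> (\<Sum>t\<in>F. cmod (f t) * cmod (left_regular G t \<xi> h))"
      unfolding left_regular_fun_def F_def by (rule norm_sum[THEN order_trans]) (simp add: norm_mult)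
    then have "(cmod (left_regular_fun G f \<xi> h))\<^sup>2
        \<le> (\<Sum>t\<in>F. cmod (f t) * cmod (left_regular G t \<xi> h))\<^sup>2"
      by (intro power_mono) auto
    also have "\<dots> \<le> ?b h"
      unfolding M_def by (rule Cauchy_Schwarz_ineq_sum)
    finally show ?thesis .
  qed
  have "((\<lambda>h. \<Sum>t\<in>F. (cmod (left_regular G t \<xi> h))\<^sup>2) has_sum (\<Sum>t\<in>F. (ell2_norm G \<xi>)\<^sup>2)) (carrier G)"
    using F assms(2) by (intro has_sum_finite_sum left_regular_isometry) auto
  from has_sum_cmult_right[OF this, of M]
  have b: "(?b has_sum (K * ell2_norm G \<xi>)\<^sup>2) (carrier G)"
    using M0 by (simp add: K_def M_def F_def power_mult_distrib mult.assoc)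
  have summable: "(\<lambda>h. (cmod (left_regular_fun G f \<xi> h))\<^sup>2) summable_on carrier G"
    by (rule summable_on_comparison_test[of ?b])
       (use b pointwise in \<open>auto intro: has_sum_imp_summable\<close>)
  then show "left_regular_fun G f \<xi> \<in> ell2 G"
    by (simp add: ell2_def)
  have "(ell2_norm G (left_regular_fun G f \<xi>))\<^sup>2 \<le> (K * ell2_norm G \<xi>)\<^sup>2"
    unfolding ell2_norm_power2 using has_sum_infsum[OF summable] b pointwise
    by (rule has_sum_mono)
  moreover have "0 \<le> K" by (simp add: K_def sum_nonneg)
  ultimately show "ell2_norm G (left_regular_fun G f \<xi>) \<le> K * ell2_norm G \<xi>"
    by (meson power2_le_imp_le mult_nonneg_nonneg ell2_norm_nonneg)
qed

text \<open>
  The defining property of an operator norm, by rescaling \<open>\<xi>\<close> to a unit vector.  A vector of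
  norm \<open>0\<close> cannot be rescaled; its image has norm \<open>0\<close> by the elementary bound.
\<close>

lemma ell2_norm_left_regular_fun_le:
  assumes f: "finite (supp G f)" and \<xi>: "\<xi> \<in> ell2 G"
  shows "ell2_norm G (left_regular_fun G f \<xi>)
      \<le> ell2_op_norm G (left_regular_fun G f) * ell2_norm G \<xi>"
proof (cases "ell2_norm G \<xi> = 0")
  case True
  then show ?thesis using left_regular_fun_bounded(2)[OF f \<xi>] by simp
next
  case False
  define r where "r = ell2_norm G \<xi>"
  have r: "r > 0" using False ell2_norm_nonneg[of G \<xi>] by (simp add: r_def)
  define \<eta> where "\<eta> = (\<lambda>g. complex_of_real (1 / r) * \<xi> g)"
  have \<eta>: "\<eta> \<in> ell2 G" "ell2_norm G \<eta> = 1"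
    using r \<xi> unfolding \<eta>_def
    by (auto intro: ell2_scale simp: ell2_norm_scale r_def[symmetric] norm_divide simp del: of_real_divide)
  define K where "K = sqrt ((\<Sum>t\<in>supp G f. (cmod (f t))\<^sup>2) * real (card (supp G f)))"
  have K: "0 \<le> K" by (simp add: K_def sum_nonneg)
  have "ell2_norm G (left_regular_fun G f \<zeta>) \<le> K"
    if "\<zeta> \<in> ell2 G" "ell2_norm G \<zeta> \<le> 1" for \<zeta>
    using left_regular_fun_bounded(2)[OF f that(1)] mult_left_mono[OF that(2) K]
    by (simp add: K_def)
  then have "bdd_above ((\<lambda>\<zeta>. ell2_norm G (left_regular_fun G f \<zeta>)) `
      {\<zeta> \<in> ell2 G. ell2_norm G \<zeta> \<le> 1})"
    by (intro bdd_aboveI2[where M = K]) auto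
  then have "ell2_norm G (left_regular_fun G f \<eta>) \<le> ell2_op_norm G (left_regular_fun G f)"
    unfolding ell2_op_norm_def using \<eta> by (intro cSUP_upper) auto
  moreover have "left_regular_fun G f \<eta> =
      (\<lambda>h. complex_of_real (1 / r) * left_regular_fun G f \<xi> h)"
    by (simp add: fun_eq_iff left_regular_fun_def left_regular_def \<eta>_def sum_distrib_left mult_ac)
  ultimately have "ell2_norm G (left_regular_fun G f \<xi>) / r \<le> ell2_op_norm G (left_regular_fun G f)"
    using r by (simp only: ell2_norm_scale norm_of_real) simp
  then show ?thesis using r by (simp add: r_def[symmetric] field_simps)
qed

section \<open>Product sets\<close>

lemma set_mult_eq_image: "A <#> B = (\<lambda>(a, b). a \<otimes> b) ` (A \<times> B)"
  by (auto simp: set_mult_def)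

text \<open>
  Double counting: a fixed \<open>a \<in> A\<close> is the left factor in \<open>|B|\<close> factorisations, one for each
  point of the translate \<open>aB \<subseteq> AB\<close>.
\<close>

lemma sum_convolution_indicators:
  assumes "finite A" "finite B" "A \<subseteq> carrier G" "B \<subseteq> carrier G"
  shows "(\<Sum>h\<in>A <#> B. left_regular_fun G (indicator A) (indicator B) h)
      = of_nat (card A * card B)"
proof -
  have supp: "supp G (indicator A) = A"
    using assms by (auto simp: supp_def indicator_def)
  have fin: "finite (A <#> B)"
    using assms by (simp add: set_mult_eq_image)
  have translate: "card {h \<in> A <#> B. inv a \<otimes> h \<in> B} = card B" if "a \<in> A" for a
  proof -
    have "bij_betw (\<lambda>b. a \<otimes> b) B {h \<in> A <#> B. inv a \<otimes> h \<in> B}"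
    proof (rule bij_betw_byWitness[where f' = "\<lambda>h. inv a \<otimes> h"])
      show "(\<lambda>b. a \<otimes> b) ` B \<subseteq> {h \<in> A <#> B. inv a \<otimes> h \<in> B}"
        using assms that by (auto simp: set_mult_def m_assoc[symmetric] subset_iff)
      show "\<forall>h\<in>{h \<in> A <#> B. inv a \<otimes> h \<in> B}. a \<otimes> (inv a \<otimes> h) = h"
        using assms that by (auto simp: set_mult_def m_assoc[symmetric] subset_iff)
      show "\<forall>b\<in>B. inv a \<otimes> (a \<otimes> b) = b"
        using assms that by (auto simp: m_assoc[symmetric] subset_iff)
    qed auto
    then show ?thesis by (simp add: bij_betw_same_card)
  qed
  have "(\<Sum>h\<in>A <#> B. left_regular_fun G (indicator A) (indicator B) h)
      = (\<Sum>h\<in>A <#> B. \<Sum>a\<in>A. indicator B (inv a \<otimes> h) :: complex)"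
    by (simp add: left_regular_fun_def supp left_regular_def)
  also have "\<dots> = (\<Sum>a\<in>A. \<Sum>h\<in>A <#> B. indicator B (inv a \<otimes> h))"
    by (rule sum.swap)
  also have "\<dots> = (\<Sum>a\<in>A. of_nat (card {h \<in> A <#> B. inv a \<otimes> h \<in> B}))"
    using fin by (simp add: indicator_def sum.If_cases Int_def)
  also have "\<dots> = of_nat (card A * card B)"
    by (simp add: translate)
  finally show ?thesis .
qed

text \<open>
  The lower bound \<open>|A| |B| / sqrt |AB|\<close> for the norm of \<open>\<phi> = \<lambda>(1\<^sub>A) 1\<^sub>B\<close>, from
  Cauchy-Schwarz on \<open>AB\<close>, meets the upper bound from rapid decay.  Word length enters only
  through the Sobolev norm of \<open>1\<^sub>A\<close>, so \<open>B\<close> may lie anywhere in the group.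
\<close>

lemma card_set_mult_ge_left:
  assumes RD: "rapid_decay G S s C" and C: "C > 0" and s: "s \<ge> 0"
    and fin: "finite A" "finite B"
    and A: "A \<subseteq> word_ball G S n" and B: "B \<subseteq> carrier G"
  shows "real (card A) * real (card B)
      \<le> C\<^sup>2 * (1 + real n) powr (2 * s) * real (card (A <#> B))"
proof (cases "A = {} \<or> B = {}")
  case True
  then show ?thesis by auto
next
  case False
  define \<phi> where "\<phi> = left_regular_fun G (indicator A) (indicator B)"
  define a b p w where "a = real (card A)" and "b = real (card B)"
    and "p = real (card (A <#> B))" and "w = (1 + real n) powr (2 * s)"
  have Ac: "A \<subseteq> carrier G" using A by (auto simp: word_ball_def)
  have supp: "supp G (indicator A) = A"
    using Ac by (auto simp: supp_def indicator_def)
  have AB: "finite (A <#> B)" "A <#> B \<subseteq> carrier G"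
    using fin Ac B by (auto simp: set_mult_eq_image)
  have ab: "a > 0" "b > 0" using False fin by (auto simp: a_def b_def card_gt_0_iff)
  note ind = ell2_indicator[OF fin(2) B]
  have "(sobolev_norm G S s (indicator A))\<^sup>2
      = (\<Sum>g\<in>A. (1 + real (word_length G S g)) powr (2 * s))"
    unfolding sobolev_norm_def supp by (simp add: sum_nonneg)
  also have "\<dots> \<le> (\<Sum>g\<in>A. w)"
    unfolding w_def using A s by (intro sum_mono powr_mono2) (auto simp: word_ball_def)
  finally have sobolev: "(sobolev_norm G S s (indicator A))\<^sup>2 \<le> a * w"
    by (simp add: a_def)
  have "ell2_norm G \<phi> \<le> ell2_op_norm G (left_regular_fun G (indicator A)) * sqrt b"
    unfolding \<phi>_def b_def ind(2)[symmetric]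
    by (rule ell2_norm_left_regular_fun_le) (use supp fin ind in auto)
  also have "\<dots> \<le> C * sobolev_norm G S s (indicator A) * sqrt b"
    using RD supp fin ab by (intro mult_right_mono) (auto simp: rapid_decay_def)
  finally have "(ell2_norm G \<phi>)\<^sup>2 \<le> (C * sobolev_norm G S s (indicator A) * sqrt b)\<^sup>2"
    by (intro power_mono ell2_norm_nonneg)
  also have "\<dots> = C\<^sup>2 * b * (sobolev_norm G S s (indicator A))\<^sup>2"
    using ab by (simp add: power_mult_distrib)
  also have "\<dots> \<le> C\<^sup>2 * b * (a * w)"
    using sobolev ab by (intro mult_left_mono) auto
  finally have upper: "(ell2_norm G \<phi>)\<^sup>2 \<le> C\<^sup>2 * b * (a * w)" .
  have "a * b = cmod (\<Sum>h\<in>A <#> B. \<phi> h)"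
    unfolding \<phi>_def sum_convolution_indicators[OF fin Ac B] norm_of_nat by (simp add: a_def b_def)
  also have "\<dots> \<le> (\<Sum>h\<in>A <#> B. 1 * cmod (\<phi> h))"
    using norm_sum by simp
  finally have "(a * b)\<^sup>2 \<le> (\<Sum>h\<in>A <#> B. 1 * cmod (\<phi> h))\<^sup>2"
    using ab by (intro power_mono) auto
  also have "\<dots> \<le> (\<Sum>h\<in>A <#> B. 1\<^sup>2) * (\<Sum>h\<in>A <#> B. (cmod (\<phi> h))\<^sup>2)"
    by (rule Cauchy_Schwarz_ineq_sum)
  also have "\<dots> \<le> p * (ell2_norm G \<phi>)\<^sup>2"
    using AB left_regular_fun_bounded(1)[of "indicator A" "indicator B"] supp fin ind
    by (auto simp: p_def \<phi>_def intro!: mult_left_mono sum_le_ell2_norm_power2)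
  also have "\<dots> \<le> p * (C\<^sup>2 * b * (a * w))"
    using upper by (intro mult_left_mono) (auto simp: p_def)
  finally have "(a * b) * (a * b) \<le> (a * b) * (C\<^sup>2 * w * p)"
    by (simp add: power2_eq_square mult_ac)
  then show ?thesis
    using ab unfolding a_def[symmetric] b_def[symmetric] p_def[symmetric] w_def[symmetric]
    by (subst (asm) mult_le_cancel_left_pos) auto
qed

section \<open>Inversion\<close>

lemma foldr_mult_start_value:
  assumes "set ws \<subseteq> carrier G" "x \<in> carrier G"
  shows "foldr (\<otimes>) ws x = foldr (\<otimes>) ws \<one> \<otimes> x \<and> foldr (\<otimes>) ws \<one> \<in> carrier G"
  using assms by (induction ws) (auto simp: m_assoc)

lemma inv_foldr_mult:
  assumes "set ws \<subseteq> carrier G"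
  shows "inv (foldr (\<otimes>) ws \<one>) = foldr (\<otimes>) (rev (map (m_inv G) ws)) \<one>"
  using assms
proof (induction ws)
  case (Cons w ws)
  then have "inv (foldr (\<otimes>) (w # ws) \<one>) = foldr (\<otimes>) (rev (map (m_inv G) ws)) \<one> \<otimes> inv w"
    using foldr_mult_start_value[of ws \<one>] by (simp add: inv_mult_group)
  also have "\<dots> = foldr (\<otimes>) (rev (map (m_inv G) ws)) (inv w)"
    using Cons.prems foldr_mult_start_value[of "rev (map (m_inv G) ws)" "inv w"] by force
  finally show ?case using Cons.prems by simp
qed simp

text \<open>
  Reversing a word and inverting its letters again gives a word over \<open>S \<union> S\<inverse>\<close>, of the same
  length and representing the inverse element.
\<close>

lemma word_length_inv:
  assumes S: "S \<subseteq> carrier G" and g: "g \<in> carrier G"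
  shows "word_length G S (inv g) = word_length G S g"
proof -
  let ?W = "\<lambda>g n. \<exists>ws. length ws = n \<and> set ws \<subseteq> S \<union> m_inv G ` S \<and> foldr (\<otimes>) ws \<one> = g"
  have inverse_word: "?W (inv x) n" if W: "?W x n" and "x \<in> carrier G" for x n
  proof -
    from W obtain ws where ws: "length ws = n" "set ws \<subseteq> S \<union> m_inv G ` S" "foldr (\<otimes>) ws \<one> = x"
      by blast
    have "set ws \<subseteq> carrier G" using ws(2) S by auto
    then have "foldr (\<otimes>) (rev (map (m_inv G) ws)) \<one> = inv x"
      using inv_foldr_mult[of ws] ws(3) by simp
    moreover have "set (rev (map (m_inv G) ws)) \<subseteq> S \<union> m_inv G ` S"
    proof -
      have "inv y \<in> S \<union> m_inv G ` S" if "y \<in> S \<union> m_inv G ` S" for y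
        using that S by (auto simp: subset_iff)
      then show ?thesis using ws(2) by (simp only: set_rev set_map) blast
    qed
    ultimately show ?thesis using ws(1) by (intro exI[of _ "rev (map (m_inv G) ws)"]) simp
  qed
  have "?W (inv g) n \<longleftrightarrow> ?W g n" for n
    using inverse_word[where x = g] inverse_word[where x = "inv g"] g by (metis inv_closed inv_inv)
  then show ?thesis by (simp add: word_length_def)
qed

lemma set_mult_inverses:
  assumes "A \<subseteq> carrier G" "B \<subseteq> carrier G"
  shows "(m_inv G ` B) <#> (m_inv G ` A) = m_inv G ` (A <#> B)"
  using assms by (force simp: set_mult_def inv_mult_group[symmetric] subset_iff)

lemma card_image_inv: "A \<subseteq> carrier G \<Longrightarrow> card (m_inv G ` A) = card A"
  by (rule card_image, rule inj_on_subset[OF inv_inj])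

text \<open>
  The estimate for the left factor, applied to \<open>B\<inverse>A\<inverse> = (AB)\<inverse>\<close>.
\<close>

lemma card_set_mult_ge_right:
  assumes RD: "rapid_decay G S s C" and C: "C > 0" and s: "s \<ge> 0"
    and S: "S \<subseteq> carrier G" and fin: "finite A" "finite B"
    and A: "A \<subseteq> carrier G" and B: "B \<subseteq> word_ball G S k"
  shows "real (card A) * real (card B)
      \<le> C\<^sup>2 * (1 + real k) powr (2 * s) * real (card (A <#> B))"
proof -
  have Bc: "B \<subseteq> carrier G" using B by (auto simp: word_ball_def)
  have AB: "A <#> B \<subseteq> carrier G" using A Bc by (auto simp: set_mult_def)
  have "m_inv G ` B \<subseteq> word_ball G S k"
    using B S by (auto simp: word_ball_def word_length_inv)
  moreover have "m_inv G ` A \<subseteq> carrier G" using A by auto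
  ultimately show ?thesis
    using card_set_mult_ge_left[OF RD C s, of "m_inv G ` B" "m_inv G ` A" k] fin
    by (simp add: set_mult_inverses[OF A Bc] card_image_inv A Bc AB mult.commute)
qed

end

section \<open>Product growth\<close>

theorem theorem1p7:
  fixes G :: "('a, 'm) monoid_scheme" and S :: "'a set" and s C :: real
  assumes "group G"
    and "finite S" and "generates G S"
    and "s \<ge> 0" and "C > 0"
    and "rapid_decay G S s C"
  shows "(\<forall>(n::nat) (k::nat) A B.
            finite A \<longrightarrow> finite B \<longrightarrow> A \<noteq> {} \<longrightarrow> B \<noteq> {} \<longrightarrow>
            A \<subseteq> word_ball G S n \<longrightarrow> B \<subseteq> word_ball G S k \<longrightarrow>
            real (card (A <#>\<^bsub>G\<^esub> B)) \<ge>
              real (card A) * real (card B) / (C\<^sup>2 * (1 + real (min n k)) powr (2 * s)))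
         \<and> large_product_growth G S"
proof -
  interpret group G by fact
  have S: "S \<subseteq> carrier G" using assms(3) by (simp add: generates_def)
  let ?D = "\<lambda>n k. C\<^sup>2 * (1 + real (min n k)) powr (2 * s)"
  have D_pos: "?D n k > 0" for n k using \<open>C > 0\<close> by simp
  have main: "real (card A) * real (card B) / ?D n k \<le> real (card (A <#>\<^bsub>G\<^esub> B))"
    if fin: "finite A" "finite B" and A: "A \<subseteq> word_ball G S n" and B: "B \<subseteq> word_ball G S k"
    for n k A B
  proof -
    have "A \<subseteq> carrier G" "B \<subseteq> carrier G" using A B by (auto simp: word_ball_def)
    then have "real (card A) * real (card B) \<le> ?D n k * real (card (A <#>\<^bsub>G\<^esub> B))"
      using card_set_mult_ge_left[OF assms(6,5,4) fin A]
        card_set_mult_ge_right[OF assms(6,5,4) S fin _ B]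
      by (cases "n \<le> k") (auto simp: min_def)
    then show ?thesis using D_pos[of n k] by (simp add: divide_le_eq mult.commute)
  qed
  \<comment> \<open>\<open>2 * s\<close> need not be an integer, so the exponent is rounded up, which only enlarges powers
    of the base \<open>1 + n + k \<ge> 1\<close>.\<close>
  define N where "N = nat \<lceil>2 * s\<rceil>"
  define P where "P = smult (C\<^sup>2) ([:1, 1:] ^ N)"
  have P: "poly P x = C\<^sup>2 * (1 + x) ^ N" for x
    by (simp add: P_def)
  have D_le_P: "?D n k \<le> poly P (real (n + k))" for n k
  proof -
    have "(1 + real (min n k)) powr (2 * s) \<le> (1 + real (n + k)) powr (2 * s)"
      using \<open>s \<ge> 0\<close> by (intro powr_mono2) auto
    also have "\<dots> \<le> (1 + real (n + k)) powr real N"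
      by (intro powr_mono) (auto simp: N_def of_nat_ceiling)
    also have "\<dots> = (1 + real (n + k)) ^ N"
      by (rule powr_realpow) simp
    finally show ?thesis by (simp add: P mult_left_mono)
  qed
  have "large_product_growth G S"
    unfolding large_product_growth_def
  proof (intro exI[of _ P] conjI allI impI)
    show "poly P (real m) > 0" for m using \<open>C > 0\<close> by (simp add: P)
  next
    fix n k U V
    assume UV: "finite U" "finite V" "U \<subseteq> word_ball G S n" "V \<subseteq> word_ball G S k"
    have "real (card U) * real (card V) / poly P (real (n + k))
        \<le> real (card U) * real (card V) / ?D n k"
      using D_pos[of n k] D_le_P[of n k] by (intro divide_left_mono mult_pos_pos) auto
    also have "\<dots> \<le> real (card (U <#>\<^bsub>G\<^esub> V))"
      by (rule main) (use UV in auto)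
    finally show "real (card (U <#>\<^bsub>G\<^esub> V)) \<ge>
        real (card U) * real (card V) / poly P (real (n + k))" .
  qed
  with main show ?thesis by blast
qed

end
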